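(* Let $M\in\mathbb{N}$, let $g\in\mathbb{C}^M$, let $F\subset\mathbb{Z}_M$ with $F\neq\emptyset$, and let $(g,\Lambda)$ be the Gabor system with window $g$ and $\Lambda=F\times\mathbb{Z}_M$. For $m\in\mathbb{Z}_M$ put $F_m=\{m-k\}_{k\in F}\subset\mathbb{Z}_M$ and let $g_{F_m}$ be the restriction of $g$ to the set of coordinates $F_m$. Then $(g,\Lambda)$ is a frame for $\mathbb{C}^M$ if and only if $\min_{m\in\mathbb{Z}_M}\{\|g_{F_m}\|_2\}\neq 0$. Moreover, in this case the optimal lower and upper frame bounds for $(g,\Lambda)$ are $$A=M\min_{m\in\mathbb{Z}_M}\{\|g_{F_m}\|_2^2\}\quad\text{and}\quad B=M\max_{m\in\mathbb{Z}_M}\{\|g_{F_m}\|_2^2\},$$ respectively.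
   Context: Vectors $x\in\mathbb{C}^M$ are viewed as functions $x:\mathbb{Z}_M\to\mathbb{C}$, with index arithmetic modulo $M$. For $(k,\ell)\in\mathbb{Z}_M\times\mathbb{Z}_M$, the time-frequency shift operator $\pi(k,\ell)$ on $\mathbb{C}^M$ is $(\pi(k,\ell)x)(m)=e^{2\pi i\ell m/M}x(m-k)$. The Gabor system generated by the window $g$ and the set $\Lambda\subset\mathbb{Z}_M\times\mathbb{Z}_M$ is the family $(g,\Lambda)=\{\pi(k,\ell)g\}_{(k,\ell)\in\Lambda}$ (indexed by $\Lambda$). A finite family $\{\varphi_j\}_{j=1}^N\subset\mathbb{C}^M$ is a frame with frame bounds $0<A\le B$ if $A\|x\|_2^2\le\sum_{j=1}^N|\langle x,\varphi_j\rangle|^2\le B\|x\|_2^2$ for all $x\in\mathbb{C}^M$ (equivalently, some such bounds exist iff the family spans $\mathbb{C}^M$). The optimal lower and upper frame bounds are the largest possible $A$ and the smallest possible $B$, i.e. the minimum and maximum of $\sum_j|\langle x,\varphi_j\rangle|^2$ over $\|x\|_2=1$. *)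

theory Defs
  imports "HOL-Analysis.Analysis" "Berlekamp_Zassenhaus.Finite_Field"
begin

text \<open>
  The type \<open>'n mod_ring\<close> is the additive group of integers modulo \<open>M = CARD('n)\<close>, for an
  arbitrary \<open>M \<ge> 1\<close>. A vector of dimension \<open>M\<close> is an element of \<open>complex ^ 'n mod_ring\<close>,
  on which the library's \<open>norm\<close> is the Euclidean norm.
\<close>

text \<open>
  The library's \<open>inner\<close> on complex vectors is real-valued, hence this sesquilinear product.
\<close>
definition cvec_inner :: "complex ^ 'm \<Rightarrow> complex ^ 'm \<Rightarrow> complex" where
  "cvec_inner x y = (\<Sum>i\<in>UNIV. x $ i * cnj (y $ i))"

definition frame_bounds ::
    "'j set \<Rightarrow> ('j \<Rightarrow> complex ^ 'm) \<Rightarrow> real \<Rightarrow> real \<Rightarrow> bool" where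
  "frame_bounds J \<phi> A B \<longleftrightarrow> finite J \<and> 0 < A \<and> A \<le> B \<and>
     (\<forall>x. A * (norm x)\<^sup>2 \<le> (\<Sum>j\<in>J. (cmod (cvec_inner x (\<phi> j)))\<^sup>2) \<and>
          (\<Sum>j\<in>J. (cmod (cvec_inner x (\<phi> j)))\<^sup>2) \<le> B * (norm x)\<^sup>2)"

definition is_frame :: "'j set \<Rightarrow> ('j \<Rightarrow> complex ^ 'm) \<Rightarrow> bool" where
  "is_frame J \<phi> \<longleftrightarrow> (\<exists>A B. frame_bounds J \<phi> A B)"

definition optimal_lower_frame_bound ::
    "'j set \<Rightarrow> ('j \<Rightarrow> complex ^ 'm) \<Rightarrow> real \<Rightarrow> bool" where
  "optimal_lower_frame_bound J \<phi> A \<longleftrightarrow>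
     (\<exists>B. frame_bounds J \<phi> A B) \<and> (\<forall>A' B'. frame_bounds J \<phi> A' B' \<longrightarrow> A' \<le> A)"

definition optimal_upper_frame_bound ::
    "'j set \<Rightarrow> ('j \<Rightarrow> complex ^ 'm) \<Rightarrow> real \<Rightarrow> bool" where
  "optimal_upper_frame_bound J \<phi> B \<longleftrightarrow>
     (\<exists>A. frame_bounds J \<phi> A B) \<and> (\<forall>A' B'. frame_bounds J \<phi> A' B' \<longrightarrow> B \<le> B')"

text \<open>
  \<open>to_int_mod_ring\<close> picks the representative in \<open>{0..<M}\<close>; the exponential does not depend on
  this choice.
\<close>
definition time_freq_shift ::
    "'n::finite mod_ring \<Rightarrow> 'n mod_ring \<Rightarrow> complex ^ 'n mod_ring \<Rightarrow> complex ^ 'n mod_ring" where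
  "time_freq_shift k l x =
     (\<chi> m. exp (2 * of_real pi * \<i> * of_int (to_int_mod_ring l) * of_int (to_int_mod_ring m)
                 / of_nat CARD('n)) * x $ (m - k))"

text \<open>The Gabor system generated by \<open>g\<close> and \<open>\<Lambda>\<close> is the family \<open>gabor_system g\<close> on the
  index set \<open>\<Lambda>\<close>.\<close>
definition gabor_system ::
    "complex ^ 'n::finite mod_ring \<Rightarrow> 'n mod_ring \<times> 'n mod_ring \<Rightarrow> complex ^ 'n mod_ring" where
  "gabor_system g = (\<lambda>(k, l). time_freq_shift k l g)"

definition reflected_shift :: "'n::finite mod_ring set \<Rightarrow> 'n mod_ring \<Rightarrow> 'n mod_ring set" where
  "reflected_shift F m = (\<lambda>k. m - k) ` F"

text \<open>The Euclidean norm of the restriction of \<open>g\<close> to \<open>S\<close>, written as a norm over the index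
  set \<open>S\<close> since \<open>S\<close> is not a type.\<close>
definition restr_norm :: "complex ^ 'm \<Rightarrow> 'm set \<Rightarrow> real" where
  "restr_norm g S = L2_set (\<lambda>i. cmod (g $ i)) S"

end

theory Submission
  imports Defs
begin

text \<open>
  For each fixed shift \<open>k\<close>, Parseval's identity over the modulations \<open>l\<close> shows that the frame
  operator of the Gabor system is diagonal, with entry \<open>M \<parallel>g restricted to F\<^sub>m\<parallel>\<^sup>2\<close> at \<open>m\<close>.
  The optimal frame bounds are therefore the extreme diagonal entries, attained at the standard
  basis vectors.
\<close>

text \<open>The phase factor of \<open>time_freq_shift\<close>: the \<open>l\<close>-th character of
  the cyclic group evaluated at \<open>m\<close>, isolated so that orthogonality can be treated
  apart from the translation.\<close>

definition modulation_char :: "'n::finite mod_ring \<Rightarrow> 'n mod_ring \<Rightarrow> complex" where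
  "modulation_char l m =
     exp (2 * of_real pi * \<i> * of_int (to_int_mod_ring l) * of_int (to_int_mod_ring m)
          / of_nat CARD('n))"

lemma time_freq_shift_nth: "time_freq_shift k l x $ m = modulation_char l m * x $ (m - k)"
  by (simp add: time_freq_shift_def modulation_char_def)

lemma to_int_mod_ring_bounds:
  fixes m :: "'n::finite mod_ring"
  shows "0 \<le> to_int_mod_ring m" "to_int_mod_ring m < int CARD('n)"
  using range_to_int_mod_ring[where 'a = 'n] by fastforce+

text \<open>Serves to turn a sum over all modulations into a geometric sum with exponents from 0 to
  \<open>CARD('n) - 1\<close>.\<close>

lemma bij_betw_nat_to_int_mod_ring:
  "bij_betw (\<lambda>l :: 'n::finite mod_ring. nat (to_int_mod_ring l)) UNIV {..<CARD('n)}"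
proof (rule bij_betw_byWitness[where f' = "\<lambda>i. of_int_mod_ring (int i)"])
  show "(\<lambda>l :: 'n mod_ring. nat (to_int_mod_ring l)) ` UNIV \<subseteq> {..<CARD('n)}"
    using to_int_mod_ring_bounds[where 'n = 'n] by (auto simp: nat_less_iff)
qed (auto simp: to_int_mod_ring_bounds)

lemma sum_powers_root_unity:
  fixes w :: "'a::field"
  assumes "w ^ n = 1" "w \<noteq> 1"
  shows "(\<Sum>i<n. w ^ i) = 0"
  using assms by (simp add: geometric_sum)

lemma exp_root_unity_eq_1_iff:
  fixes d :: int
  assumes "n > 0"
  shows "exp (2 * of_real pi * \<i> * of_int d / of_nat n) = 1 \<longleftrightarrow> int n dvd d"
proof -
  have "exp (2 * of_real pi * \<i> * of_int d / of_nat n) = 1 \<longleftrightarrow>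
      (\<exists>k::int. 2 * pi * of_int d / of_nat n = of_int (2 * k) * pi)"
    by (simp add: exp_eq_1)
  also have "\<dots> \<longleftrightarrow> (\<exists>k::int. (of_int d :: real) = of_int (int n * k))"
    using assms by (intro ex_cong1) (simp add: field_simps)
  also have "\<dots> \<longleftrightarrow> int n dvd d"
    unfolding of_int_eq_iff dvd_def ..
  finally show ?thesis .
qed

text \<open>Each summand is a power of one root of unity \<open>w\<close> that depends only on the
  difference of \<open>m\<close> and \<open>m'\<close>, so the sum is geometric and vanishes unless
  \<open>w = 1\<close>.\<close>

lemma modulation_char_orthogonal:
  fixes m m' :: "'n::finite mod_ring"
  shows "(\<Sum>l\<in>UNIV. modulation_char l m * cnj (modulation_char l m')) =
    (if m = m' then of_nat CARD('n) else 0)"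
proof -
  define d where "d = to_int_mod_ring m - to_int_mod_ring m'"
  define w :: complex where "w = exp (2 * of_real pi * \<i> * of_int d / of_nat CARD('n))"
  have char: "modulation_char l m * cnj (modulation_char l m') = w ^ nat (to_int_mod_ring l)"
    for l :: "'n mod_ring"
  proof -
    have "(of_nat (nat (to_int_mod_ring l)) :: complex) = of_int (to_int_mod_ring l)"
      using to_int_mod_ring_bounds(1)[of l] by simp
    then show ?thesis
      unfolding modulation_char_def w_def d_def exp_cnj exp_of_nat_mult[symmetric]
        exp_add[symmetric]
      by (simp add: field_simps)
  qed
  have "(\<Sum>l\<in>UNIV. modulation_char l m * cnj (modulation_char l m')) = (\<Sum>i<CARD('n). w ^ i)"
    unfolding char by (rule sum.reindex_bij_betw[OF bij_betw_nat_to_int_mod_ring])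
  also have "\<dots> = (if m = m' then of_nat CARD('n) else 0)"
  proof (cases "m = m'")
    case True
    then show ?thesis by (simp add: w_def d_def)
  next
    case False
    then have "d \<noteq> 0"
      using to_int_mod_ring_hom.injectivity by (auto simp: d_def)
    \<comment> \<open>Both representatives lie between 0 and \<open>CARD('n) - 1\<close>, so a
      nonzero difference is too small to be a multiple of \<open>CARD('n)\<close>.\<close>
    moreover have "\<bar>d\<bar> < int CARD('n)"
      using to_int_mod_ring_bounds[of m] to_int_mod_ring_bounds[of m'] by (auto simp: d_def)
    ultimately have "\<not> int CARD('n) dvd d"
      using zdvd_not_zless[of "\<bar>d\<bar>" "int CARD('n)"] by auto
    then have "w \<noteq> 1"
      by (simp add: w_def exp_root_unity_eq_1_iff)
    moreover have "w ^ CARD('n) = 1"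
      by (simp add: w_def exp_of_nat_mult[symmetric] exp_eq_1)
    ultimately show ?thesis
      using False by (simp add: sum_powers_root_unity)
  qed
  finally show ?thesis .
qed

text \<open>Expanding the squared modulus gives a double sum over \<open>m\<close> and
  \<open>m'\<close>; once the sum over \<open>l\<close> is innermost, orthogonality leaves only the
  diagonal.\<close>

lemma parseval_modulation_char:
  fixes y :: "'n::finite mod_ring \<Rightarrow> complex"
  shows "(\<Sum>l\<in>UNIV. (cmod (\<Sum>m\<in>UNIV. y m * cnj (modulation_char l m)))\<^sup>2) =
    real CARD('n) * (\<Sum>m\<in>UNIV. (cmod (y m))\<^sup>2)"
proof -
  let ?c = modulation_char
  \<comment> \<open>The computation runs over the complex numbers, where the squared modulus of z is
    z times its conjugate; injectivity of \<open>of_real\<close> brings it back to the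
    reals.\<close>
  have "complex_of_real (\<Sum>l\<in>UNIV. (cmod (\<Sum>m\<in>UNIV. y m * cnj (?c l m)))\<^sup>2) =
      (\<Sum>l\<in>UNIV. \<Sum>m\<in>UNIV. \<Sum>m'\<in>UNIV. y m * cnj (y m') * (?c l m' * cnj (?c l m)))"
    unfolding of_real_sum complex_norm_square cnj_sum sum_product by (simp add: mult_ac)
  also have "\<dots> = (\<Sum>m\<in>UNIV. \<Sum>l\<in>UNIV. \<Sum>m'\<in>UNIV. y m * cnj (y m') * (?c l m' * cnj (?c l m)))"
    by (rule sum.swap)
  also have "\<dots> = (\<Sum>m\<in>UNIV. \<Sum>m'\<in>UNIV. \<Sum>l\<in>UNIV. y m * cnj (y m') * (?c l m' * cnj (?c l m)))"
    by (intro sum.cong refl sum.swap)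
  also have "\<dots> = (\<Sum>m\<in>UNIV. \<Sum>m'\<in>UNIV. if m' = m then of_nat CARD('n) * (y m * cnj (y m')) else 0)"
    by (intro sum.cong refl)
      (simp add: sum_distrib_left[symmetric] modulation_char_orthogonal)
  also have "\<dots> = complex_of_real (real CARD('n) * (\<Sum>m\<in>UNIV. (cmod (y m))\<^sup>2))"
    by (simp add: complex_norm_square sum_distrib_left del: of_real_power)
  finally show ?thesis
    by (simp only: of_real_eq_iff)
qed

lemma restr_norm_reflected_shift_power2:
  "(restr_norm g (reflected_shift F m))\<^sup>2 = (\<Sum>k\<in>F. (cmod (g $ (m - k)))\<^sup>2)"
proof -
  \<comment> \<open>Distinct shifts hit distinct coordinates, so reindexing counts none
    twice.\<close>
  have "inj_on (\<lambda>k. m - k) F" by (auto simp: inj_on_def)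
  then show ?thesis
    by (simp add: restr_norm_def reflected_shift_def L2_set_def sum_nonneg sum.reindex)
qed

lemma gabor_system_frame_operator_diagonal:
  fixes g x :: "complex ^ 'n::finite mod_ring"
  shows "(\<Sum>j\<in>F \<times> UNIV. (cmod (cvec_inner x (gabor_system g j)))\<^sup>2) =
    (\<Sum>m\<in>UNIV. real CARD('n) * (restr_norm g (reflected_shift F m))\<^sup>2 * (cmod (x $ m))\<^sup>2)"
proof -
  have "(\<Sum>j\<in>F \<times> UNIV. (cmod (cvec_inner x (gabor_system g j)))\<^sup>2) =
      (\<Sum>k\<in>F. \<Sum>l\<in>UNIV. (cmod (cvec_inner x (time_freq_shift k l g)))\<^sup>2)"
    by (simp add: gabor_system_def sum.cartesian_product case_prod_unfold)
  \<comment> \<open>For fixed \<open>k\<close> the window is absorbed into the vector, which makes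
    the inner products the character coefficients of a single sequence, as Parseval
    requires.\<close>
  also have "\<dots> = (\<Sum>k\<in>F. \<Sum>l\<in>UNIV. (cmod (\<Sum>m\<in>UNIV.
      (x $ m * cnj (g $ (m - k))) * cnj (modulation_char l m)))\<^sup>2)"
    by (simp add: cvec_inner_def time_freq_shift_nth mult_ac)
  also have "\<dots> = (\<Sum>k\<in>F. \<Sum>m\<in>UNIV.
      real CARD('n) * (cmod (g $ (m - k)))\<^sup>2 * (cmod (x $ m))\<^sup>2)"
    unfolding parseval_modulation_char
    by (simp add: norm_mult power_mult_distrib sum_distrib_left mult_ac)
  also have "\<dots> = (\<Sum>m\<in>UNIV. \<Sum>k\<in>F.
      real CARD('n) * (cmod (g $ (m - k)))\<^sup>2 * (cmod (x $ m))\<^sup>2)"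
    by (rule sum.swap)
  also have "\<dots> = (\<Sum>m\<in>UNIV.
      real CARD('n) * (restr_norm g (reflected_shift F m))\<^sup>2 * (cmod (x $ m))\<^sup>2)"
    by (simp add: restr_norm_reflected_shift_power2 sum_distrib_left sum_distrib_right)
  finally show ?thesis .
qed

lemma norm_vec_power2: "(norm (x :: complex ^ 'm::finite))\<^sup>2 = (\<Sum>m\<in>UNIV. (cmod (x $ m))\<^sup>2)"
  by (simp add: norm_vec_def L2_set_def sum_nonneg)

text \<open>Testing on standard basis vectors isolates each weight \<open>c m\<close> and gives
  necessity; comparing the weighted sum with the squared norm term by term gives
  sufficiency.\<close>

lemma frame_bounds_diagonal_iff:
  fixes \<phi> :: "'j \<Rightarrow> complex ^ 'm::finite"
  assumes "finite J"
    and diag: "\<And>x. (\<Sum>j\<in>J. (cmod (cvec_inner x (\<phi> j)))\<^sup>2) = (\<Sum>m\<in>UNIV. c m * (cmod (x $ m))\<^sup>2)"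
  shows "frame_bounds J \<phi> A B \<longleftrightarrow> 0 < A \<and> A \<le> Min (range c) \<and> Max (range c) \<le> B"
proof
  assume fb: "frame_bounds J \<phi> A B"
  have "A \<le> c m \<and> c m \<le> B" for m
  proof -
    let ?e = "axis m 1 :: complex ^ 'm"
    have nth: "(cmod (?e $ i))\<^sup>2 = (if i = m then 1 else 0)" for i
      by (simp add: axis_def)
    have "(norm ?e)\<^sup>2 = 1"
      unfolding norm_vec_power2 nth by simp
    moreover have "(\<Sum>i\<in>UNIV. c i * (cmod (?e $ i))\<^sup>2) = c m"
      unfolding nth by (simp add: if_distrib cong: if_cong)
    ultimately show ?thesis
      using fb unfolding frame_bounds_def diag by (metis mult.right_neutral)
  qed
  then show "0 < A \<and> A \<le> Min (range c) \<and> Max (range c) \<le> B"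
    using fb by (auto simp: frame_bounds_def)
next
  assume bounds: "0 < A \<and> A \<le> Min (range c) \<and> Max (range c) \<le> B"
  then have c: "A \<le> c m" "c m \<le> B" for m
    by auto
  have "A \<le> B" using c order_trans by blast
  then show "frame_bounds J \<phi> A B"
    using assms(1) bounds c unfolding frame_bounds_def diag norm_vec_power2 sum_distrib_left
    by (auto intro!: sum_mono mult_right_mono)
qed

theorem proposition3p1:
  fixes g :: "complex ^ 'n::finite mod_ring"
    and F :: "'n mod_ring set"
  assumes "F \<noteq> {}"
  shows "(is_frame (F \<times> UNIV) (gabor_system g) \<longleftrightarrow>
            Min (range (\<lambda>m. restr_norm g (reflected_shift F m))) \<noteq> 0) \<and>
         (is_frame (F \<times> UNIV) (gabor_system g) \<longrightarrow>
            optimal_lower_frame_bound (F \<times> UNIV) (gabor_system g)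
              (real CARD('n) * Min (range (\<lambda>m. (restr_norm g (reflected_shift F m))\<^sup>2))) \<and>
            optimal_upper_frame_bound (F \<times> UNIV) (gabor_system g)
              (real CARD('n) * Max (range (\<lambda>m. (restr_norm g (reflected_shift F m))\<^sup>2))))"
proof -
  define r where "r = (\<lambda>m. restr_norm g (reflected_shift F m))"
  define c where "c = (\<lambda>m. real CARD('n) * (r m)\<^sup>2)"
  have fb: "frame_bounds (F \<times> UNIV) (gabor_system g) A B \<longleftrightarrow>
      0 < A \<and> A \<le> Min (range c) \<and> Max (range c) \<le> B" for A B
    by (rule frame_bounds_diagonal_iff)
      (simp_all add: gabor_system_frame_operator_diagonal c_def r_def)
  have r_nonneg: "0 \<le> r m" for m
    by (simp add: r_def restr_norm_def)
  have mono: "mono (\<lambda>t. real CARD('n) * t)"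
    by (auto intro!: monoI mult_left_mono)
  have Min_c: "Min (range c) = real CARD('n) * Min (range (\<lambda>m. (r m)\<^sup>2))"
    using mono_Min_commute[OF mono, of "range (\<lambda>m. (r m)\<^sup>2)"]
    by (simp add: c_def image_image)
  have Max_c: "Max (range c) = real CARD('n) * Max (range (\<lambda>m. (r m)\<^sup>2))"
    using mono_Max_commute[OF mono, of "range (\<lambda>m. (r m)\<^sup>2)"]
    by (simp add: c_def image_image)
  \<comment> \<open>For the backward direction the witnesses are \<open>Min (range c)\<close> and
    \<open>Max (range c)\<close> themselves.\<close>
  have frame: "is_frame (F \<times> UNIV) (gabor_system g) \<longleftrightarrow> 0 < Min (range c)"
    unfolding is_frame_def fb by (meson less_le_trans order_refl)
  also have "\<dots> \<longleftrightarrow> 0 < Min (range r)"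
  proof -
    have "0 < c m \<longleftrightarrow> 0 < r m" for m
      using r_nonneg[of m] by (auto simp: c_def zero_less_mult_iff less_le)
    then show ?thesis by simp
  qed
  \<comment> \<open>The minimum is attained, hence nonnegative, so being nonzero means being
    positive. \<open>Min_gr_iff\<close> is disabled to keep the minimum from being unfolded into a
    statement about all elements.\<close>
  also have "\<dots> \<longleftrightarrow> Min (range r) \<noteq> 0"
    using r_nonneg Min_in[of "range r"] by (auto simp: less_le simp del: Min_gr_iff)
  finally have "is_frame (F \<times> UNIV) (gabor_system g) \<longleftrightarrow> Min (range r) \<noteq> 0" .
  \<comment> \<open>By \<open>fb\<close> the conditions on \<open>A\<close> and on \<open>B\<close>
    are independent, so both extremes can be read off.\<close>
  moreover have "optimal_lower_frame_bound (F \<times> UNIV) (gabor_system g) (Min (range c)) \<and>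
      optimal_upper_frame_bound (F \<times> UNIV) (gabor_system g) (Max (range c))"
    if "is_frame (F \<times> UNIV) (gabor_system g)"
    using that unfolding frame optimal_lower_frame_bound_def optimal_upper_frame_bound_def fb
    by blast
  ultimately show ?thesis
    unfolding Min_c Max_c r_def by blast
qed

end
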